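(* Let $N$ and $N'$ be positive integers and let $a,b,d$ be complex parameters. Then $$F_{1:1}^{0:3}\left[{-\atop d}:{a,b,-N\atop 1+a+b-N-d};{d-a,d-b,-N'\atop 1-a-b-N'+d};1,1\right]=\frac{(d-a,\,d-b)_N\,(a,\,b)_{N'}}{(d)_{N+N'}\,(d-a-b)_N\,(a+b-d)_{N'}}.$$
   Context: $(x)_m=x(x+1)\cdots(x+m-1)$, $(x)_0=1$, is the Pochhammer symbol, and $(x_1,\dots,x_r)_m=(x_1)_m\cdots(x_r)_m$. The Kampé de Fériet series is $$F_{1:1}^{0:3}\left[{-\atop d}:{a,b,c\atop e};{a',b',c'\atop e'};x,y\right]=\sum_{m,n=0}^\infty\frac{(a,b,c)_m(a',b',c')_n}{(d)_{m+n}(e)_m(e')_n}\frac{x^my^n}{m!\,n!}.$$ In the claim it is a finite sum over $0\le m\le N$, $0\le n\le N'$. It is understood that no denominator parameter of the series (here $d$, $1+a+b-N-d$, $1-a-b-N'+d$) is zero or a negative integer. *)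

theory Defs
  imports "HOL-Analysis.Analysis" "HOL-Library.Nonpos_Ints"
begin

definition mpochhammer :: "complex list \<Rightarrow> nat \<Rightarrow> complex" where
  "mpochhammer xs m = (\<Prod>x\<leftarrow>xs. pochhammer x m)"

text \<open>
  The Kampe de Feriet series $F^{0:3}_{1:1}$, as an unconditional sum over all pairs
  \<open>(m, n)\<close>. The arguments are \<open>d\<close>, then the lists \<open>a, b, c; e\<close> and \<open>a', b', c'; e'\<close>, then
  \<open>x\<close> and \<open>y\<close>. It is meaningful only if none of \<open>d\<close>, \<open>e\<close>, \<open>e'\<close> is zero or a negative integer,
  since division by zero yields zero.
\<close>
definition kampe_de_feriet ::
  "complex \<Rightarrow> complex \<Rightarrow> complex \<Rightarrow> complex \<Rightarrow> complex
    \<Rightarrow> complex \<Rightarrow> complex \<Rightarrow> complex \<Rightarrow> complex \<Rightarrow> complex \<Rightarrow> complex \<Rightarrow> complex" where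
  "kampe_de_feriet d a b c e a' b' c' e' x y =
    (\<Sum>\<^sub>\<infinity>(m, n)\<in>UNIV.
      mpochhammer [a, b, c] m * mpochhammer [a', b', c'] n
        / (pochhammer d (m + n) * pochhammer e m * pochhammer e' n)
        * (x ^ m * y ^ n / (fact m * fact n)))"

end

theory Submission
  imports Defs
begin

text \<open>
  Put \<open>c = d - a - b\<close>. Reversing the two terminating parameters turns \<open>(-N)_m / (1-c-N)_m\<close> into a
  constant times \<open>(c)_(N-m) / (N-m)!\<close>, which is a coefficient of the binomial series \<open>(1-x)^(-c)\<close>;
  similarly, \<open>(-N')_n / (1+c-N')_n\<close> gives a coefficient of \<open>(1-y)^c\<close>. The double sum is therefore,
  up to a constant, the coefficient of \<open>x^N y^N'\<close> in \<open>(1-x)^(-c) (1-y)^c F(x,y)\<close>, where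
  \<open>F(x,y) = F3(a, d-a; b, d-b; d; x, y)\<close> is Appell's series. The right-hand side is, up to the same
  constant, a coefficient of the series \<open>G\<close> obtained from \<open>F\<close> by replacing \<open>a, b\<close> with \<open>d-a, d-b\<close>.
  So the theorem amounts to the transformation
  \<open>(1-x)^(-c) (1-y)^c F(x,y) = G(x,y)\<close>.

  Analytically this holds because \<open>(1-y)^c F(x,y)\<close> is a function of \<open>x + y - xy\<close> alone. The proof uses
  only the infinitesimal form of that fact, the first-order equation
  \<open>(1-x) F_x = (1-y) F_y - c F\<close>, which is a contiguity relation for the coefficients of \<open>F\<close>
  (\<open>F3_coeff_rec\<close>). It implies that \<open>(1-x)^(-c) (1-y)^c F\<close> and \<open>G\<close> both satisfy
  \<open>(1-x) H_x = (1-y) H_y + c H\<close>. Read as a recurrence in the powers of \<open>y\<close>, this equation determines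
  a solution from its value at \<open>y = 0\<close>, and there the two series agree by Euler's transformation of
  \<open>2F1\<close> (\<open>euler_transformation\<close>).
\<close>

unbundle no vec_syntax and fps_syntax

section \<open>The binomial series and Euler's transformation\<close>

text \<open>The series \<open>(1 - X)^(-c)\<close>.\<close>
definition binomial_fps :: "'a::field_char_0 \<Rightarrow> 'a fps" where
  "binomial_fps c = Abs_fps (\<lambda>k. pochhammer c k / fact k)"

lemma binomial_coeff_Suc:
  fixes c :: "'a::field_char_0"
  shows "of_nat (Suc k) * (pochhammer c (Suc k) / fact (Suc k)) = (c + of_nat k) * (pochhammer c k / fact k)"
  by (simp add: pochhammer_Suc field_simps del: of_nat_Suc)

lemma fps_one_minus_X_deriv_nth:
  fixes F :: "'a::field_char_0 fps"
  shows "((1 - fps_X) * fps_deriv F) $ n = of_nat (Suc n) * F $ Suc n - of_nat n * F $ n"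
  by (cases n) (simp_all add: algebra_simps)

text \<open>Together with the Leibniz rule, this equation allows differential equations to be
  transferred from a series to its product with \<open>(1 - X)^(-c)\<close>.\<close>
lemma binomial_fps_deriv:
  "(1 - fps_X) * fps_deriv (binomial_fps c) = fps_const c * binomial_fps c"
proof (rule fps_ext)
  fix n
  show "((1 - fps_X) * fps_deriv (binomial_fps c)) $ n = (fps_const c * binomial_fps c) $ n"
    unfolding fps_one_minus_X_deriv_nth binomial_fps_def fps_nth_Abs_fps binomial_coeff_Suc
    by (simp add: distrib_right add_divide_distrib)
qed

definition hypergeometric_fps :: "'a::field_char_0 \<Rightarrow> 'a \<Rightarrow> 'a \<Rightarrow> 'a fps" where
  "hypergeometric_fps a b d =
     Abs_fps (\<lambda>m. pochhammer a m * pochhammer b m / (pochhammer d m * fact m))"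

text \<open>Gauss's hypergeometric differential operator.\<close>
definition hypergeometric_op :: "'a::field_char_0 \<Rightarrow> 'a \<Rightarrow> 'a \<Rightarrow> 'a fps \<Rightarrow> 'a fps" where
  "hypergeometric_op a b d F =
     fps_X * (1 - fps_X) * fps_deriv (fps_deriv F)
     + (fps_const d - fps_const (a + b + 1) * fps_X) * fps_deriv F - fps_const (a * b) * F"

text \<open>Each coefficient of the differential equation links two consecutive coefficients of the series.
  This shows both that \<open>2F1\<close> solves the equation and that a power series solution is determined by
  its constant term, unless a factor \<open>d + n\<close> vanishes.\<close>
lemma hypergeometric_op_nth:
  "hypergeometric_op a b d F $ n =
     of_nat (Suc n) * (d + of_nat n) * F $ Suc n - (a + of_nat n) * (b + of_nat n) * F $ n"
proof -
  have op: "hypergeometric_op a b d F =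
      fps_X * fps_deriv (fps_deriv F) - fps_X * (fps_X * fps_deriv (fps_deriv F))
      + fps_const d * fps_deriv F - fps_const (a + b + 1) * (fps_X * fps_deriv F) - fps_const (a * b) * F"
    unfolding hypergeometric_op_def by (simp add: algebra_simps)
  show ?thesis
  proof (cases n)
    case (Suc m)
    thus ?thesis
      unfolding op by (cases m) (simp_all add: algebra_simps)
  qed (simp add: op)
qed

lemma hypergeometric_op_hypergeometric_fps:
  fixes d :: "'a::field_char_0"
  assumes d: "\<And>n. d + of_nat n \<noteq> 0"
  shows "hypergeometric_op a b d (hypergeometric_fps a b d) = 0"
proof (rule fps_ext)
  fix n
  have "pochhammer d n \<noteq> 0"
    using d by (metis add.left_inverse pochhammer_eq_0_iff)
  thus "hypergeometric_op a b d (hypergeometric_fps a b d) $ n = 0 $ n"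
    using d[of n]
    by (simp add: hypergeometric_op_nth hypergeometric_fps_def pochhammer_Suc divide_simps
             del: of_nat_Suc)
qed

lemma hypergeometric_op_unique:
  fixes d :: "'a::field_char_0"
  assumes d: "\<And>n. d + of_nat n \<noteq> 0"
    and F: "hypergeometric_op a b d F = 0" and G: "hypergeometric_op a b d G = 0"
    and init: "F $ 0 = G $ 0"
  shows "F = G"
proof (rule fps_ext)
  fix n show "F $ n = G $ n"
  proof (induction n)
    case (Suc n)
    have "of_nat (Suc n) * (d + of_nat n) * F $ Suc n = (a + of_nat n) * (b + of_nat n) * F $ n"
         "of_nat (Suc n) * (d + of_nat n) * G $ Suc n = (a + of_nat n) * (b + of_nat n) * G $ n"
      using hypergeometric_op_nth[of a b d F n] hypergeometric_op_nth[of a b d G n] F G by simp_all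
    hence "of_nat (Suc n) * (d + of_nat n) * F $ Suc n = of_nat (Suc n) * (d + of_nat n) * G $ Suc n"
      using Suc by simp
    thus ?case using d[of n] by (simp del: of_nat_Suc)
  qed (fact init)
qed

text \<open>Multiplication by \<open>E = (1-X)^(-c)\<close> conjugates one hypergeometric equation into another: with
  \<open>K = E F\<close>, the equations \<open>(1-X) (E G)' = c E G + (1-X) E G'\<close> for \<open>G = F\<close> and \<open>G = F'\<close> express
  \<open>E F'\<close> and \<open>E F''\<close> through \<open>K\<close>, \<open>K'\<close> and \<open>K''\<close>. That leads to a division by \<open>1 - X\<close>, so the
  new equation is first obtained with this extra factor, which is then cancelled.\<close>
lemma hypergeometric_op_mult_binomial:
  fixes a b d :: "'a::field_char_0"
  assumes F: "hypergeometric_op a b d F = 0"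
  shows "hypergeometric_op (d - a) (d - b) d (binomial_fps (d - a - b) * F) = 0"
proof -
  define c E x where "c = fps_const (d - a - b)" and "E = binomial_fps (d - a - b)"
    and "x = (fps_X :: 'a fps)"
  define K P Q where "K = E * F" and "P = E * fps_deriv F" and "Q = E * fps_deriv (fps_deriv F)"
  define a' b' d' where "a' = fps_const a" and "b' = fps_const b" and "d' = fps_const d"
  note param_defs = a'_def b'_def d'_def c_def
  have c: "c = d' - a' - b'"
    by (simp add: param_defs)
  have E': "(1 - x) * fps_deriv E = c * E"
    unfolding E_def c_def x_def by (rule binomial_fps_deriv)
  have leibniz: "(1 - x) * fps_deriv (E * G) = c * (E * G) + (1 - x) * (E * fps_deriv G)" for G
  proof -
    have "(1 - x) * fps_deriv (E * G) = ((1 - x) * fps_deriv E) * G + (1 - x) * (E * fps_deriv G)"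
      by (simp add: algebra_simps)
    thus ?thesis
      by (simp only: E' mult.assoc)
  qed
  have K': "(1 - x) * fps_deriv K = c * K + (1 - x) * P"
    unfolding K_def P_def by (rule leibniz)
  have P': "(1 - x) * fps_deriv P = c * P + (1 - x) * Q"
    unfolding P_def Q_def by (rule leibniz)
  have "fps_deriv ((1 - x) * fps_deriv K) = fps_deriv (c * K + (1 - x) * P)"
    by (simp only: K')
  hence "(1 - x) * fps_deriv (fps_deriv K) - fps_deriv K
      = c * fps_deriv K - P + (1 - x) * fps_deriv P"
    by (simp add: x_def c_def algebra_simps)
  hence "(1 - x) * fps_deriv (fps_deriv K) = c * fps_deriv K - P + (c * P + (1 - x) * Q) + fps_deriv K"
    by (simp only: P' diff_eq_eq)
  hence K'': "(1 - x) * fps_deriv (fps_deriv K) = (1 + c) * fps_deriv K + (c - 1) * P + (1 - x) * Q"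
    by (simp only: ring_distribs mult_1 add_ac diff_conv_add_uminus mult_minus_left)
  have "E * hypergeometric_op a b d F = 0"
    using F by simp
  hence ode: "x * (1 - x) * Q + (d' - (a' + b' + 1) * x) * P - a' * b' * K = 0"
    unfolding hypergeometric_op_def x_def param_defs K_def P_def Q_def
    by (simp add: algebra_simps flip: fps_const_add fps_const_mult)
  define L where "L = d' - ((d' - a') + (d' - b') + 1) * x"
  \<comment> \<open>The multipliers eliminate first \<open>K''\<close>, then \<open>K'\<close>, and finally \<open>Q\<close>; the terms in \<open>P\<close> and \<open>K\<close>
    that remain cancel because \<open>c = d - a - b\<close>.\<close>
  have "(1 - x) * (x * (1 - x) * fps_deriv (fps_deriv K) + L * fps_deriv K - (d' - a') * (d' - b') * K)
      = x * (1 - x) * ((1 - x) * fps_deriv (fps_deriv K)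
          - ((1 + c) * fps_deriv K + (c - 1) * P + (1 - x) * Q))
        + (x * (1 + c) + L) * ((1 - x) * fps_deriv K - (c * K + (1 - x) * P))
        + (1 - x) * (x * (1 - x) * Q + (d' - (a' + b' + 1) * x) * P - a' * b' * K)"
    unfolding c L_def by algebra
  also have "\<dots> = 0"
    unfolding K' K'' ode by simp
  finally have "(1 - x) * (x * (1 - x) * fps_deriv (fps_deriv K) + L * fps_deriv K
      - (d' - a') * (d' - b') * K) = 0" .
  moreover have "x * (1 - x) * fps_deriv (fps_deriv K) + L * fps_deriv K - (d' - a') * (d' - b') * K
      = hypergeometric_op (d - a) (d - b) d K"
    unfolding hypergeometric_op_def L_def x_def param_defs
    by (simp flip: fps_const_add fps_const_sub fps_const_mult)
  moreover have "1 - x \<noteq> 0"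
    unfolding x_def by (metis eq_iff_diff_eq_0 fps_X_neq_one)
  ultimately show ?thesis
    unfolding K_def E_def by simp
qed

text \<open>Both sides have constant term 1 and solve the hypergeometric equation with parameters
  \<open>d - a\<close>, \<open>d - b\<close>, \<open>d\<close>.\<close>
lemma euler_transformation:
  fixes a b d :: "'a::field_char_0"
  assumes "\<And>n. d + of_nat n \<noteq> 0"
  shows "binomial_fps (d - a - b) * hypergeometric_fps a b d = hypergeometric_fps (d - a) (d - b) d"
proof (rule hypergeometric_op_unique[OF assms])
  show "hypergeometric_op (d - a) (d - b) d (binomial_fps (d - a - b) * hypergeometric_fps a b d) = 0"
    by (intro hypergeometric_op_mult_binomial hypergeometric_op_hypergeometric_fps assms)
  show "hypergeometric_op (d - a) (d - b) d (hypergeometric_fps (d - a) (d - b) d) = 0"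
    by (intro hypergeometric_op_hypergeometric_fps assms)
qed (simp add: binomial_fps_def hypergeometric_fps_def)

section \<open>A transformation of Appell's series F3\<close>

text \<open>The coefficient of \<open>x^m y^n\<close> in Appell's series \<open>F3(a, d-a; b, d-b; d; x, y)\<close>.\<close>
definition F3_coeff :: "'a::field_char_0 \<Rightarrow> 'a \<Rightarrow> 'a \<Rightarrow> nat \<Rightarrow> nat \<Rightarrow> 'a" where
  "F3_coeff a b d m n =
     pochhammer a m * pochhammer b m * pochhammer (d - a) n * pochhammer (d - b) n
       / (pochhammer d (m + n) * fact m * fact n)"

text \<open>A power series in two variables is treated as the sequence of its coefficients with respect to
  \<open>y\<close>, which are power series in \<open>x\<close>.\<close>
definition F3_row :: "'a::field_char_0 \<Rightarrow> 'a \<Rightarrow> 'a \<Rightarrow> nat \<Rightarrow> 'a fps" where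
  "F3_row a b d n = Abs_fps (\<lambda>m. F3_coeff a b d m n)"

text \<open>The equation \<open>(1-x) F_x = (1-y) F_y - c F\<close>, coefficientwise. With the coefficient of
  \<open>x^m y^n\<close> factored out it becomes a polynomial identity over the common denominator \<open>d + m + n\<close>; the
  identity depends on the numerator parameters being paired as \<open>a, d - a\<close> and \<open>b, d - b\<close>.\<close>
lemma F3_coeff_rec:
  fixes d :: "'a::field_char_0"
  assumes d: "\<And>n. d + of_nat n \<noteq> 0"
  shows "of_nat (Suc m) * F3_coeff a b d (Suc m) n - of_nat m * F3_coeff a b d m n
    = of_nat (Suc n) * F3_coeff a b d m (Suc n) - (of_nat n + (d - a - b)) * F3_coeff a b d m n"
proof -
  define s where "s = d + of_nat (m + n)"
  define t where "t = F3_coeff a b d m n"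
  have s: "s \<noteq> 0"
    unfolding s_def by (rule d)
  have 1: "of_nat (Suc m) * F3_coeff a b d (Suc m) n = (a + of_nat m) * (b + of_nat m) / s * t"
  proof -
    define u :: 'a where "u = of_nat (Suc m)"
    have "u \<noteq> 0"
      unfolding u_def by (rule of_nat_neq_0)
    thus ?thesis
      by (simp add: F3_coeff_def t_def pochhammer_Suc fact_Suc s_def[symmetric] u_def[symmetric]
          divide_simps mult_ac del: of_nat_Suc of_nat_add)
  qed
  have 2: "of_nat (Suc n) * F3_coeff a b d m (Suc n)
      = (d - a + of_nat n) * (d - b + of_nat n) / s * t"
  proof -
    define u :: 'a where "u = of_nat (Suc n)"
    have "u \<noteq> 0"
      unfolding u_def by (rule of_nat_neq_0)
    thus ?thesis
      by (simp add: F3_coeff_def t_def pochhammer_Suc fact_Suc s_def[symmetric] u_def[symmetric]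
          divide_simps mult_ac del: of_nat_Suc of_nat_add)
  qed
  have "(a + of_nat m) * (b + of_nat m) - of_nat m * s
      = (d - a + of_nat n) * (d - b + of_nat n) - (of_nat n + (d - a - b)) * s"
    unfolding s_def by (simp add: algebra_simps)
  hence "((a + of_nat m) * (b + of_nat m) - of_nat m * s) / s
      = ((d - a + of_nat n) * (d - b + of_nat n) - (of_nat n + (d - a - b)) * s) / s"
    by (rule arg_cong)
  hence "(a + of_nat m) * (b + of_nat m) / s - of_nat m
      = (d - a + of_nat n) * (d - b + of_nat n) / s - (of_nat n + (d - a - b))"
    by (simp only: diff_divide_distrib nonzero_mult_div_cancel_right[OF s])
  thus ?thesis
    unfolding 1 2 t_def[symmetric] left_diff_distrib[symmetric] by (rule arg_cong)
qed

lemma F3_row_deriv: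
  fixes d :: "'a::field_char_0"
  assumes d: "\<And>n. d + of_nat n \<noteq> 0"
  shows "(1 - fps_X) * fps_deriv (F3_row a b d n)
    = of_nat (Suc n) * F3_row a b d (Suc n) - fps_const (of_nat n + (d - a - b)) * F3_row a b d n"
proof (rule fps_ext)
  fix m
  show "((1 - fps_X) * fps_deriv (F3_row a b d n)) $ m = (of_nat (Suc n) * F3_row a b d (Suc n)
      - fps_const (of_nat n + (d - a - b)) * F3_row a b d n) $ m"
    unfolding fps_one_minus_X_deriv_nth F3_row_def fps_nth_Abs_fps F3_coeff_rec[OF d]
    by (simp add: fps_of_nat[symmetric] del: of_nat_Suc)
qed

text \<open>The identity \<open>(1-y)^c ((1-y) F_y - c F) = (1-y) H_y\<close> for \<open>H = (1-y)^c F\<close>, written for the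
  coefficients of \<open>y^k\<close>.\<close>
lemma binomial_convolution_rec:
  fixes F :: "nat \<Rightarrow> 'a::field_char_0 fps"
  defines "q \<equiv> \<lambda>c k. fps_const (pochhammer c k / fact k)"
  shows "(\<Sum>n\<le>k. q (-c) (k - n) * (of_nat (Suc n) * F (Suc n) - fps_const (of_nat n + c) * F n))
    = of_nat (Suc k) * (\<Sum>n\<le>Suc k. q (-c) (Suc k - n) * F n)
      - of_nat k * (\<Sum>n\<le>k. q (-c) (k - n) * F n)"
proof -
  have q: "of_nat (Suc k - n) * q (-c) (Suc k - n) = fps_const (of_nat (k - n) - c) * q (-c) (k - n)"
    if "n \<le> k" for n
    using that binomial_coeff_Suc[of "k - n" "-c"]
    by (simp add: q_def Suc_diff_le fps_of_nat[symmetric] del: of_nat_Suc of_nat_diff)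
  \<comment> \<open>Splitting \<open>k + 1 = n + (k + 1 - n)\<close> is the Leibniz rule for \<open>H_y\<close>.\<close>
  have "of_nat (Suc k) * (\<Sum>n\<le>Suc k. q (-c) (Suc k - n) * F n)
      = (\<Sum>n\<le>Suc k. (of_nat n + of_nat (Suc k - n)) * q (-c) (Suc k - n) * F n)"
    by (simp only: sum_distrib_left, intro sum.cong refl)
       (simp add: mult.assoc flip: of_nat_add del: of_nat_Suc of_nat_diff)
  also have "\<dots> = (\<Sum>n\<le>Suc k. of_nat n * q (-c) (Suc k - n) * F n)
      + (\<Sum>n\<le>Suc k. of_nat (Suc k - n) * q (-c) (Suc k - n) * F n)"
    by (simp only: distrib_right sum.distrib)
  also have "(\<Sum>n\<le>Suc k. of_nat n * q (-c) (Suc k - n) * F n)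
      = (\<Sum>n\<le>k. of_nat (Suc n) * q (-c) (k - n) * F (Suc n))"
    by (subst sum.atMost_Suc_shift) (simp del: of_nat_Suc)
  also have "(\<Sum>n\<le>Suc k. of_nat (Suc k - n) * q (-c) (Suc k - n) * F n)
      = (\<Sum>n\<le>k. fps_const (of_nat (k - n) - c) * q (-c) (k - n) * F n)"
    using q by (simp del: of_nat_diff)
  also have "\<dots> = of_nat k * (\<Sum>n\<le>k. q (-c) (k - n) * F n)
      - (\<Sum>n\<le>k. q (-c) (k - n) * (fps_const (of_nat n + c) * F n))"
    unfolding sum_distrib_left sum_subtractf[symmetric]
    by (intro sum.cong refl)
       (simp add: of_nat_diff fps_of_nat[symmetric] algebra_simps
          flip: fps_const_add fps_const_sub)
  finally show ?thesis
    by (simp add: right_diff_distrib sum_subtractf mult_ac del: of_nat_Suc sum.atMost_Suc)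
qed

text \<open>The coefficient of \<open>y^k\<close> in \<open>(1-x)^(-c) (1-y)^c F = G\<close>. For \<open>k = 0\<close> this is Euler's
  transformation. For the step, both sides satisfy \<open>(1-x) H_x = (1-y) H_y + c H\<close>, which gives
  \<open>(k + 1)\<close> times the next coefficient in terms of the present one. That \<open>G\<close> satisfies it is
  the equation for \<open>F\<close> again, since replacing \<open>a, b\<close> with \<open>d - a, d - b\<close> changes the sign of \<open>c\<close>.\<close>
lemma F3_transformation:
  fixes a b d :: "'a::field_char_0"
  assumes d: "\<And>n. d + of_nat n \<noteq> 0"
  defines "c \<equiv> d - a - b"
  shows "binomial_fps c * (\<Sum>n\<le>k. fps_const (pochhammer (-c) (k - n) / fact (k - n)) * F3_row a b d n)
    = F3_row (d - a) (d - b) d k"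
proof (induction k)
  case 0
  have "F3_row a b d 0 = hypergeometric_fps a b d" for a b
    by (simp add: F3_row_def F3_coeff_def hypergeometric_fps_def)
  thus ?case
    using euler_transformation[OF d] by (simp add: c_def)
next
  case (Suc k)
  define S where "S k = (\<Sum>n\<le>k. fps_const (pochhammer (-c) (k - n) / fact (k - n)) * F3_row a b d n)" for k
  define H where "H k = binomial_fps c * S k" for k
  have "(1 - fps_X) * fps_deriv (S k) = of_nat (Suc k) * S (Suc k) - of_nat k * S k"
  proof -
    have "(1 - fps_X) * fps_deriv (S k)
        = (\<Sum>n\<le>k. fps_const (pochhammer (-c) (k - n) / fact (k - n)) *
            ((1 - fps_X) * fps_deriv (F3_row a b d n)))"
      by (simp add: S_def fps_deriv_sum sum_distrib_left mult_ac)
    also have "\<dots> = of_nat (Suc k) * S (Suc k) - of_nat k * S k"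
      unfolding F3_row_deriv[OF d] S_def c_def by (rule binomial_convolution_rec)
    finally show ?thesis .
  qed
  moreover have "(1 - fps_X) * fps_deriv (H k)
      = ((1 - fps_X) * fps_deriv (binomial_fps c)) * S k + binomial_fps c * ((1 - fps_X) * fps_deriv (S k))"
    unfolding H_def by (simp add: algebra_simps)
  ultimately have "(1 - fps_X) * fps_deriv (H k)
      = fps_const c * H k + of_nat (Suc k) * H (Suc k) - of_nat k * H k"
    unfolding binomial_fps_deriv H_def
    by (simp only: right_diff_distrib mult_ac add_diff_eq)
  moreover have "H k = F3_row (d - a) (d - b) d k"
    using Suc by (simp add: H_def S_def)
  moreover have "(1 - fps_X) * fps_deriv (F3_row (d - a) (d - b) d k)
      = of_nat (Suc k) * F3_row (d - a) (d - b) d (Suc k)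
        - (of_nat k - fps_const c) * F3_row (d - a) (d - b) d k"
    unfolding F3_row_deriv[OF d]
    by (simp add: c_def fps_of_nat[symmetric] algebra_simps flip: fps_const_add fps_const_sub)
  ultimately have "of_nat (Suc k) * H (Suc k) = of_nat (Suc k) * F3_row (d - a) (d - b) d (Suc k)"
    by (simp add: algebra_simps del: of_nat_Suc)
  hence "H (Suc k) = F3_row (d - a) (d - b) d (Suc k)"
    by (simp del: of_nat_Suc)
  thus ?case
    by (simp only: H_def S_def)
qed

lemma F3_coeff_convolution:
  fixes a b d :: "'a::field_char_0"
  assumes d: "\<And>n. d + of_nat n \<noteq> 0"
  defines "c \<equiv> d - a - b"
  shows "(\<Sum>m\<le>M. \<Sum>n\<le>N. F3_coeff a b d m n * (pochhammer c (M - m) / fact (M - m))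
            * (pochhammer (-c) (N - n) / fact (N - n)))
    = F3_coeff (d - a) (d - b) d M N"
proof -
  have "F3_coeff (d - a) (d - b) d M N = F3_row (d - a) (d - b) d N $ M"
    by (simp add: F3_row_def)
  also have "\<dots> = ((\<Sum>n\<le>N. fps_const (pochhammer (-c) (N - n) / fact (N - n)) * F3_row a b d n)
      * binomial_fps c) $ M"
    unfolding c_def F3_transformation[OF d, of a b, symmetric] by (simp add: mult.commute)
  also have "\<dots> = (\<Sum>m\<le>M. \<Sum>n\<le>N. F3_coeff a b d m n * (pochhammer c (M - m) / fact (M - m))
            * (pochhammer (-c) (N - n) / fact (N - n)))"
    by (subst fps_mult_nth)
       (simp add: atLeast0AtMost fps_sum_nth F3_row_def binomial_fps_def sum_distrib_left
          sum_distrib_right sum_divide_distrib mult_ac)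
  finally show ?thesis ..
qed

section \<open>Reversal of the terminating parameters\<close>

lemma pochhammer_reverse:
  fixes c :: "'a::comm_ring_1"
  assumes "m \<le> N"
  shows "pochhammer (1 - c - of_nat N) m * pochhammer c (N - m) = (-1) ^ m * pochhammer c N"
proof -
  have "pochhammer (1 - c - of_nat N) m = pochhammer (- (c + of_nat N - 1)) m"
    by (simp add: algebra_simps)
  also have "\<dots> = (-1) ^ m * pochhammer (c + of_nat (N - m)) m"
    using assms by (subst pochhammer_minus) (simp add: algebra_simps of_nat_diff)
  finally show ?thesis
    using pochhammer_product[OF diff_le_self[of N m], of c] assms by (simp add: mult_ac)
qed

text \<open>Reversal applies to the numerator as well, since \<open>-N = 1 - 1 - N\<close>; the signs then cancel and the
  numerator contributes the factorials.\<close>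
lemma terminating_quotient:
  fixes c :: "'a::field_char_0"
  assumes "m \<le> N" and "pochhammer c N \<noteq> 0"
  shows "pochhammer (- of_nat N) m / pochhammer (1 - c - of_nat N) m
    = fact N / pochhammer c N * (pochhammer c (N - m) / fact (N - m))"
proof -
  have 1: "pochhammer (- of_nat N :: 'a) m * fact (N - m) = (-1) ^ m * fact N"
    using pochhammer_reverse[OF assms(1), of "1 :: 'a"] by (simp add: pochhammer_fact)
  have 2: "pochhammer (1 - c - of_nat N) m * pochhammer c (N - m) = (-1) ^ m * pochhammer c N"
    by (rule pochhammer_reverse[OF assms(1)])
  have "pochhammer (1 - c - of_nat N) m \<noteq> 0"
    using 2 assms(2) by auto
  moreover have "(pochhammer (- of_nat N) m * fact (N - m)) * pochhammer c N
      = fact N * (pochhammer (1 - c - of_nat N) m * pochhammer c (N - m))"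
    unfolding 1 2 by (simp add: mult_ac)
  ultimately show ?thesis
    using assms(2) by (simp add: frac_eq_eq mult_ac)
qed

theorem mainTheorem9:
  fixes N N' :: nat and a b d :: complex
  assumes "N > 0" and "N' > 0"
    and "d \<notin> \<int>\<^sub>\<le>\<^sub>0"
    and "1 + a + b - of_nat N - d \<notin> \<int>\<^sub>\<le>\<^sub>0"
    and "1 - a - b - of_nat N' + d \<notin> \<int>\<^sub>\<le>\<^sub>0"
  shows "kampe_de_feriet d
           a b (- of_nat N) (1 + a + b - of_nat N - d)
           (d - a) (d - b) (- of_nat N') (1 - a - b - of_nat N' + d)
           1 1
       = mpochhammer [d - a, d - b] N * mpochhammer [a, b] N'
           / (pochhammer d (N + N') * pochhammer (d - a - b) N * pochhammer (a + b - d) N')"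
proof -
  define c where "c = d - a - b"
  have c': "a + b - d = - c" "1 + a + b - of_nat N - d = 1 - c - of_nat N"
    "1 - a - b - of_nat N' + d = 1 - (- c) - of_nat N'"
    by (simp_all add: c_def algebra_simps)
  have d: "d + of_nat n \<noteq> 0" for n
    using assms(3) by (metis add_eq_0_iff2 minus_of_nat_in_nonpos_Ints)
  \<comment> \<open>The conditions on the denominator parameters exclude \<open>c = 0, -1, \<dots>, 1 - N\<close> and
    \<open>c = 0, 1, \<dots>, N' - 1\<close>, so the reversed quotients have nonzero denominators.\<close>
  have cN: "pochhammer c N \<noteq> 0"
  proof
    assume "pochhammer c N = 0"
    then obtain k where "k < N" "c = - of_nat k"
      by (auto simp: pochhammer_eq_0_iff)
    hence "1 - c - of_nat N = - of_nat (N - Suc k)"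
      by (simp add: of_nat_diff)
    thus False
      using assms(4) unfolding c' by simp
  qed
  have cN': "pochhammer (-c) N' \<noteq> 0"
  proof
    assume "pochhammer (-c) N' = 0"
    then obtain k where "k < N'" "-c = - of_nat k"
      by (auto simp: pochhammer_eq_0_iff)
    hence "1 - (-c) - of_nat N' = - of_nat (N' - Suc k)"
      by (simp add: of_nat_diff)
    thus False
      using assms(5) unfolding c' by simp
  qed
  define t where "t m n = F3_coeff a b d m n
      * (pochhammer (- of_nat N) m / pochhammer (1 - c - of_nat N) m)
      * (pochhammer (- of_nat N') n / pochhammer (1 - (-c) - of_nat N') n)" for m n
  have "kampe_de_feriet d a b (- of_nat N) (1 + a + b - of_nat N - d)
           (d - a) (d - b) (- of_nat N') (1 - a - b - of_nat N' + d) 1 1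
      = (\<Sum>\<^sub>\<infinity>(m, n)\<in>UNIV. t m n)"
    unfolding kampe_de_feriet_def mpochhammer_def t_def F3_coeff_def c'
    by (simp add: mult_ac)
  also have "\<dots> = (\<Sum>\<^sub>\<infinity>(m, n)\<in>{..N} \<times> {..N'}. t m n)"
    by (intro infsum_cong_neutral)
       (auto simp: t_def pochhammer_of_nat_eq_0_iff not_le)
  also have "\<dots> = (\<Sum>m\<le>N. \<Sum>n\<le>N'. t m n)"
    by (simp add: sum.cartesian_product)
  also have "\<dots> = (\<Sum>m\<le>N. \<Sum>n\<le>N'. fact N / pochhammer c N * (fact N' / pochhammer (-c) N')
      * (F3_coeff a b d m n * (pochhammer c (N - m) / fact (N - m))
            * (pochhammer (-c) (N' - n) / fact (N' - n))))"
    by (intro sum.cong refl)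
       (simp only: t_def terminating_quotient[OF _ cN] terminating_quotient[OF _ cN'] atMost_iff mult_ac)
  also have "\<dots> = fact N / pochhammer c N * (fact N' / pochhammer (-c) N')
      * F3_coeff (d - a) (d - b) d N N'"
    unfolding F3_coeff_convolution[OF d, of a b, folded c_def, symmetric]
    by (simp only: sum_distrib_left)
  also have "\<dots> = mpochhammer [d - a, d - b] N * mpochhammer [a, b] N'
           / (pochhammer d (N + N') * pochhammer (d - a - b) N * pochhammer (a + b - d) N')"
    unfolding c' c_def[symmetric] by (simp add: F3_coeff_def mpochhammer_def field_simps)
  finally show ?thesis .
qed

end
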